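(* Let $v,\epsilon,\eta>0$ be constants, let $\delta x,\delta t>0$, and let $\theta_0\in(0,\pi)$. Let $\zeta(s)=\sum_{n\ge 1}n^{-s}$ denote the Riemann zeta function. Consider, for $i\in\{1,2\}$, the explicit finite difference scheme $$\frac{u_{j}^{n+1}-u_{j}^{n}}{\delta t} + v\,\frac{u^n_{j}-u^n_{j-1}}{\delta x}-\epsilon\,\frac{u^{n}_{j+1}-2u^{n}_{j}+u^{n}_{j-1}}{\delta x^{2}}+\eta\,\mathcal{I}^i_{\delta x}[u^{n}]_{j}=0,$$ with discrete nonlocal operators $\mathcal{I}^1_{\delta x},\mathcal{I}^2_{\delta x}$ and amplification factors $g_1,g_2$ as defined in the context. (1) (Scheme with $\mathcal{I}^1_{\delta x}$.) If $$\frac{v\,\delta t}{\delta x}+2\,\frac{\epsilon\,\delta t}{\delta x^2}+(2-2^{-1/3})\,\frac{\eta\,\delta t}{\delta x^{4/3}}\le 1 \quad\text{and}\quad (1-2^{-1/3})\,\frac{\eta\,\delta t}{\delta x^{4/3}}\le 2\,\frac{\epsilon\,\delta t}{\delta x^2}\,\sin^2\!\Big(\frac{\theta_0}{2}\Big),$$ then the scheme with $i=1$ is stable with threshold frequency $\theta_0$, i.e. $|g_1(\delta x,\delta t,\theta)|<1$ for all $\theta\in(\theta_0,\pi]$. (2) (Scheme with $\mathcal{I}^2_{\delta x}$.) If $$\frac{v\,\delta t}{\delta x}+2\,\frac{\epsilon\,\delta t}{\delta x^2}+\frac49\Big(\zeta(\tfrac43)-1\Big)\frac{\eta\,\delta t}{\delta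 x^{4/3}}\le 1 \quad\text{and}\quad \frac49\Big(\zeta(\tfrac73)-1+\zeta(\tfrac43)\Big)\frac{\eta\,\delta t}{\delta x^{4/3}}\le 2\,\frac{\epsilon\,\delta t}{\delta x^2}\,\sin^2\!\Big(\frac{\theta_0}{2}\Big),$$ then the scheme with $i=2$ is stable with threshold frequency $\theta_0$, i.e. $|g_2(\delta x,\delta t,\theta)|<1$ for all $\theta\in(\theta_0,\pi]$.
   Context: The discrete nonlocal operators acting on a grid function $(\varphi_j)_j$ are $$\mathcal{I}^{1}_{\delta x}[\varphi]_{j}=\delta x^{-4/3}\sum_{l=1}^{+\infty}l^{-1/3}\left(\varphi_{j-l+1}-2\varphi_{j-l}+\varphi_{j-l-1}\right),$$ $$\mathcal{I}^{2}_{\delta x}[\varphi]_{j}=\frac49\,\delta x^{-4/3}\sum_{l=1}^{+\infty}l^{-7/3}\left(\varphi_{j-l}-\varphi_{j}+l\,\frac{\varphi_{j+1}-\varphi_{j-1}}{2}\right).$$ Amplification factor: inserting a single Fourier mode $u_j^n=\hat u^n_k e^{ikx_j}$ with $x_j=j\,\delta x$ into the scheme gives $\hat u^{n+1}_k=g\,\hat u^n_k$, where $g$ depends on $\delta x,\delta t$ and $\theta=k\,\delta x$; by aliasing one considers $\theta\in[0,\pi]$. For $\mathcal{I}^1_{\delta x}$ the series is first rearranged by collecting the coefficients of $u^n_{j-l}$. Explicitly, $$g_1(\delta x,\delta t,\theta)=1-\frac{v\,\delta t}{\delta x}-2\frac{\epsilon\,\delta t}{\delta x^2}(1-\cos\theta)-\frac{\eta\,\delta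 t}{\delta x^{4/3}}+\Big(\frac{v\,\delta t}{\delta x}+(2-2^{-1/3})\frac{\eta\,\delta t}{\delta x^{4/3}}\Big)e^{-i\theta}-\frac{\eta\,\delta t}{\delta x^{4/3}}\sum_{l=2}^{\infty}\big[(l+1)^{-1/3}-2l^{-1/3}+(l-1)^{-1/3}\big]e^{-il\theta},$$ $$g_2(\delta x,\delta t,\theta)=1-\frac{v\,\delta t}{\delta x}-4\frac{\epsilon\,\delta t}{\delta x^2}\sin^2\!\Big(\frac\theta2\Big)+\frac49\Big(\zeta(\tfrac73)-\zeta(\tfrac43)\cos\theta\Big)\frac{\eta\,\delta t}{\delta x^{4/3}}+\Big(\frac{v\,\delta t}{\delta x}+\frac49\big(\zeta(\tfrac43)-1\big)\frac{\eta\,\delta t}{\delta x^{4/3}}\Big)e^{-i\theta}-\frac49\frac{\eta\,\delta t}{\delta x^{4/3}}\sum_{l=2}^{\infty}l^{-7/3}e^{-il\theta}.$$ Definition of stability: a scheme with amplification factor $g$ is called stable if there exists $0<\theta_0<\pi$ (the stability threshold frequency) such that $|g(\delta x,\delta t,\theta)|<1$ for all $\theta\in(\theta_0,\pi]$. *)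

theory Defs
  imports "HOL-Analysis.Analysis"
begin

definition zeta :: "real \<Rightarrow> real" where
  "zeta s = (\<Sum>n. real (n + 1) powr (- s))"

text \<open>
  In the series below the summation variable of \<^const>\<open>suminf\<close> starts at 0, so \<open>l + 1\<close>
  (resp. \<open>l + 2\<close>) plays the role of the index of a series starting at 1 (resp. 2).
  \<^const>\<open>suminf\<close> is the limit of the partial sums; this matters for the first operator, whose
  series is in general only conditionally convergent on Fourier modes.
\<close>

definition nonlocal1 :: "real \<Rightarrow> (int \<Rightarrow> complex) \<Rightarrow> int \<Rightarrow> complex" where
  "nonlocal1 dx \<phi> j = of_real (dx powr (-4/3)) *
     (\<Sum>l. of_real (real (l + 1) powr (-1/3)) *
          (\<phi> (j - int (l + 1) + 1) - 2 * \<phi> (j - int (l + 1)) + \<phi> (j - int (l + 1) - 1)))"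

definition nonlocal2 :: "real \<Rightarrow> (int \<Rightarrow> complex) \<Rightarrow> int \<Rightarrow> complex" where
  "nonlocal2 dx \<phi> j = of_real (4/9 * dx powr (-4/3)) *
     (\<Sum>l. of_real (real (l + 1) powr (-7/3)) *
          (\<phi> (j - int (l + 1)) - \<phi> j + of_nat (l + 1) * ((\<phi> (j + 1) - \<phi> (j - 1)) / 2)))"

definition explicit_scheme ::
  "(real \<Rightarrow> (int \<Rightarrow> complex) \<Rightarrow> int \<Rightarrow> complex) \<Rightarrow> real \<Rightarrow> real \<Rightarrow> real \<Rightarrow> real \<Rightarrow> real \<Rightarrow>
   (nat \<Rightarrow> int \<Rightarrow> complex) \<Rightarrow> bool" where
  "explicit_scheme I v \<epsilon> \<eta> dx dt u \<longleftrightarrow>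
     (\<forall>n j. (u (Suc n) j - u n j) / of_real dt
          + of_real v * ((u n j - u n (j - 1)) / of_real dx)
          - of_real \<epsilon> * ((u n (j + 1) - 2 * u n j + u n (j - 1)) / of_real (dx ^ 2))
          + of_real \<eta> * I dx (u n) j = 0)"

text \<open>
  A function \<open>g\<close> of \<open>\<theta> = k dx\<close> is the amplification factor of a scheme if a single
  Fourier mode with amplitudes \<open>uhat n\<close> on the grid \<open>x\<^sub>j = j dx\<close> solves the
  scheme exactly when the amplitudes are multiplied by \<open>g (k dx)\<close> in each time step. If
  \<open>dx \<noteq> 0\<close>, this
  determines \<open>g\<close> uniquely.
\<close>

definition amplification_factor ::
  "((nat \<Rightarrow> int \<Rightarrow> complex) \<Rightarrow> bool) \<Rightarrow> real \<Rightarrow> (real \<Rightarrow> complex) \<Rightarrow> bool" where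
  "amplification_factor S dx g \<longleftrightarrow>
     (\<forall>(k::real) (uhat::nat \<Rightarrow> complex).
        S (\<lambda>n j. uhat n * exp (\<i> * of_real (k * (of_int j * dx)))) \<longleftrightarrow>
        (\<forall>n. uhat (Suc n) = g (k * dx) * uhat n))"

definition g1 :: "real \<Rightarrow> real \<Rightarrow> real \<Rightarrow> real \<Rightarrow> real \<Rightarrow> real \<Rightarrow> complex" where
  "g1 v \<epsilon> \<eta> dx dt \<theta> =
     of_real (1 - v * dt / dx - 2 * (\<epsilon> * dt / dx ^ 2) * (1 - cos \<theta>) - \<eta> * dt / dx powr (4/3))
     + of_real (v * dt / dx + (2 - 2 powr (-1/3)) * (\<eta> * dt / dx powr (4/3)))
         * exp (- \<i> * of_real \<theta>)
     - of_real (\<eta> * dt / dx powr (4/3)) *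
         (\<Sum>l. of_real (real (l + 3) powr (-1/3) - 2 * real (l + 2) powr (-1/3)
                       + real (l + 1) powr (-1/3))
              * exp (- \<i> * of_real (real (l + 2) * \<theta>)))"

definition g2 :: "real \<Rightarrow> real \<Rightarrow> real \<Rightarrow> real \<Rightarrow> real \<Rightarrow> real \<Rightarrow> complex" where
  "g2 v \<epsilon> \<eta> dx dt \<theta> =
     of_real (1 - v * dt / dx - 4 * (\<epsilon> * dt / dx ^ 2) * (sin (\<theta> / 2)) ^ 2
       + 4/9 * (zeta (7/3) - zeta (4/3) * cos \<theta>) * (\<eta> * dt / dx powr (4/3)))
     + of_real (v * dt / dx + 4/9 * (zeta (4/3) - 1) * (\<eta> * dt / dx powr (4/3)))
         * exp (- \<i> * of_real \<theta>)
     - of_real (4/9 * (\<eta> * dt / dx powr (4/3))) *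
         (\<Sum>l. of_real (real (l + 2) powr (-7/3)) * exp (- \<i> * of_real (real (l + 2) * \<theta>)))"

definition stable_with_threshold :: "(real \<Rightarrow> complex) \<Rightarrow> real \<Rightarrow> bool" where
  "stable_with_threshold g \<theta>\<^sub>0 \<longleftrightarrow>
     0 < \<theta>\<^sub>0 \<and> \<theta>\<^sub>0 < pi \<and> (\<forall>\<theta>\<in>{\<theta>\<^sub>0<..pi}. cmod (g \<theta>) < 1)"

end

theory Submission
  imports Defs
begin

text \<open>
  On a Fourier mode with \<open>w = exp (- \<i> \<theta>)\<close>, summation by parts turns the series of
  the first operator into an absolutely convergent one with positive coefficients, because
  \<open>l powr (-1/3)\<close> is convex and tends to 0. Stability then follows from the triangle
  inequality and a case distinction on the sign of the real coefficient in front. The two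
  hypotheses alone only yield \<open>\<bar>g\<bar> \<le> 1\<close> this way (with possible equality at
  \<open>\<theta> = pi\<close>); strictness comes from the fact that a power series with positive
  coefficients is strictly smaller in modulus at a point \<open>w \<noteq> 1\<close> of the unit circle
  than at 1.
\<close>

section \<open>Power series with positive coefficients on the unit circle\<close>

lemma norm_add_mult_less:
  fixes w :: complex and a b :: real
  assumes "a > 0" "b > 0" "cmod w = 1" "w \<noteq> 1"
  shows "cmod (of_real a + of_real b * w) < a + b"
proof -
  have sq: "(Re w)\<^sup>2 + (Im w)\<^sup>2 = 1"
    using assms(3) by (simp add: cmod_def)
  have "Re w \<noteq> 1"
  proof
    assume "Re w = 1"
    with sq assms(4) show False by (auto simp: complex_eq_iff)
  qed
  then have "Re w < 1"
    using complex_Re_le_cmod[of w] assms(3) by linarith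
  \<comment> \<open>Law of cosines: only the cross term depends on the direction of
    \<open>w\<close>, and \<open>Re w < 1\<close> makes it strictly smaller than
    \<open>2 * (a * b)\<close>.\<close>
  have "(cmod (of_real a + of_real b * w))\<^sup>2 = a\<^sup>2 + b\<^sup>2 * ((Re w)\<^sup>2 + (Im w)\<^sup>2) + 2 * (a * b) * Re w"
    unfolding cmod_power2 by (simp add: power2_eq_square algebra_simps)
  also have "\<dots> < a\<^sup>2 + b\<^sup>2 * 1 + 2 * (a * b) * 1"
    unfolding sq using mult_strict_left_mono[OF \<open>Re w < 1\<close>, of "2 * (a * b)"] assms(1,2) by simp
  also have "\<dots> = (a + b)\<^sup>2"
    by (simp add: power2_eq_square algebra_simps)
  finally show ?thesis
    by (rule power2_less_imp_less) (use assms(1,2) in simp)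
qed

lemma summable_mult_unit_power:
  fixes w :: complex and c :: "nat \<Rightarrow> real"
  assumes "\<And>n. c n > 0" "summable c" "cmod w = 1"
  shows "summable (\<lambda>n. of_real (c n) * w ^ n)"
  by (rule summable_comparison_test'[OF assms(2), of 0])
    (simp add: norm_mult norm_power assms(3) less_imp_le[OF assms(1)])

text \<open>Strict inequalities do not survive a limit, so the strictness is taken from the first
  two terms alone, which point in different directions when \<open>w \<noteq> 1\<close>. The tail
  needs only the ordinary triangle inequality.\<close>

lemma norm_suminf_power_less:
  fixes w :: complex and c :: "nat \<Rightarrow> real"
  assumes pos: "\<And>n. c n > 0" and c: "summable c" and w: "cmod w = 1" "w \<noteq> 1"
  shows "cmod (\<Sum>n. of_real (c n) * w ^ n) < suminf c"
proof -
  note s = summable_mult_unit_power[OF pos c w(1)]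
  have norm_eq: "norm (of_real (c n) * w ^ n) = c n" for n
    by (simp add: norm_mult norm_power w(1) less_imp_le[OF pos])
  have "(\<Sum>n. of_real (c n) * w ^ n)
      = (\<Sum>n. of_real (c (n + 2)) * w ^ (n + 2)) + (of_real (c 0) + of_real (c 1) * w)"
    using suminf_split_initial_segment[OF s, of 2] by (simp add: eval_nat_numeral)
  also have "cmod \<dots> \<le> cmod (\<Sum>n. of_real (c (n + 2)) * w ^ (n + 2))
      + cmod (of_real (c 0) + of_real (c 1) * w)"
    by (rule norm_triangle_ineq)
  also have "\<dots> < cmod (\<Sum>n. of_real (c (n + 2)) * w ^ (n + 2)) + (c 0 + c 1)"
    using norm_add_mult_less[OF pos[of 0] pos[of 1] w] by simp
  also have "cmod (\<Sum>n. of_real (c (n + 2)) * w ^ (n + 2)) \<le> (\<Sum>n. c (n + 2))"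
  proof -
    have "summable (\<lambda>n. c (n + 2))"
      using c by (subst summable_iff_shift)
    moreover have "(\<Sum>n. norm (of_real (c (n + 2)) * w ^ (n + 2))) = (\<Sum>n. c (n + 2))"
      by (subst norm_eq) simp
    ultimately show ?thesis
      using summable_norm[of "\<lambda>n. of_real (c (n + 2)) * w ^ (n + 2)"] by (simp only: norm_eq)
  qed
  also have "(\<Sum>n. c (n + 2)) + (c 0 + c 1) = suminf c"
    using suminf_split_initial_segment[OF c, of 2] by (simp add: eval_nat_numeral)
  finally show ?thesis by simp
qed

section \<open>Convexity, second differences and summation by parts\<close>

text \<open>Follows without derivatives from \<open>x * (x + 2) < (x + 1)\<^sup>2\<close>: the
  decreasing power gives \<open>m\<^sup>2 < p * q\<close>, and the inequality of arithmetic and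
  geometric means turns this into \<open>2 * m < p + q\<close>.\<close>

lemma powr_minus_strict_midpoint:
  fixes x s :: real
  assumes "x > 0" "s > 0"
  shows "2 * (x + 1) powr (- s) < (x + 2) powr (- s) + x powr (- s)"
proof -
  define p q m where "p = x powr (- s)" and "q = (x + 2) powr (- s)" and "m = (x + 1) powr (- s)"
  have pos: "p > 0" "q > 0" "m > 0"
    using assms by (auto simp: p_def q_def m_def)
  have "m\<^sup>2 = ((x + 1) * (x + 1)) powr (- s)"
    using assms by (simp add: m_def power2_eq_square powr_mult)
  also have "\<dots> < (x * (x + 2)) powr (- s)"
    using assms by (intro powr_less_mono2_neg) (auto simp: algebra_simps intro!: add_pos_pos)
  also have "\<dots> = p * q"
    using assms by (simp add: p_def q_def powr_mult)
  finally have "m\<^sup>2 < p * q" .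
  moreover have "(q + p)\<^sup>2 = 4 * (p * q) + (q - p)\<^sup>2"
    by (simp add: power2_eq_square algebra_simps)
  ultimately have "4 * m\<^sup>2 < (q + p)\<^sup>2"
    using zero_le_power2[of "q - p"] by linarith
  then have "(2 * m)\<^sup>2 < (q + p)\<^sup>2"
    by (simp add: power_mult_distrib)
  then have "2 * m < q + p"
    using pos by (intro power2_less_imp_less[of "2 * m" "q + p"]) auto
  then show ?thesis by (simp add: p_def q_def m_def)
qed

text \<open>The first differences telescope and tend to 0. For the sequence (l+1)^(-1/3) the sum is
  1 - 2^(-1/3), the constant in the threshold condition of the first scheme.\<close>

lemma second_difference_sums:
  fixes a :: "nat \<Rightarrow> real"
  assumes "a \<longlonglongrightarrow> 0"
  shows "(\<lambda>l. a (l + 2) - 2 * a (l + 1) + a l) sums (a 0 - a 1)"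
proof -
  have "(\<lambda>l. a (Suc l) - a l) \<longlonglongrightarrow> 0 - 0"
    by (intro tendsto_diff LIMSEQ_Suc assms)
  then have "(\<lambda>l. (a (Suc (Suc l)) - a (Suc l)) - (a (Suc l) - a l)) sums ((0 - 0) - (a (Suc 0) - a 0))"
    by (rule telescope_sums)
  then show ?thesis
    by (simp add: algebra_simps)
qed

text \<open>Collects equal powers of \<open>w\<close> in a partial sum. The last two terms are the
  boundary contributions, which vanish in the limit when \<open>a\<close> tends to 0.\<close>

lemma sum_second_difference_by_parts:
  fixes a :: "nat \<Rightarrow> complex"
  shows "(\<Sum>l<N. a l * (w ^ l - 2 * w ^ (l + 1) + w ^ (l + 2)))
    = a 0 + (a 1 - 2 * a 0) * w + (\<Sum>l<N. (a (l + 2) - 2 * a (l + 1) + a l) * w ^ (l + 2))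
      - a N * w ^ N + (2 * a N - a (Suc N)) * w ^ Suc N"
  by (induction N) (simp_all add: algebra_simps)

text \<open>The left-hand series need not converge absolutely, so its terms cannot be reordered
  freely. Its partial sums are rearranged instead; the series that results converges absolutely
  because its positive coefficients have a telescoping sum.\<close>

lemma second_difference_by_parts_sums:
  fixes a :: "nat \<Rightarrow> real" and w :: complex
  assumes a0: "a \<longlonglongrightarrow> 0" and w: "cmod w = 1"
    and convex: "\<And>l. a (l + 2) - 2 * a (l + 1) + a l > 0"
  shows "(\<lambda>l. of_real (a l) * (w ^ l - 2 * w ^ (l + 1) + w ^ (l + 2))) sums
    (of_real (a 0) + of_real (a 1 - 2 * a 0) * w
      + (\<Sum>l. of_real (a (l + 2) - 2 * a (l + 1) + a l) * w ^ (l + 2)))"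
proof -
  define c where "c l = a (l + 2) - 2 * a (l + 1) + a l" for l
  have "c l > 0" for l
    unfolding c_def by (rule convex)
  moreover have "summable c"
    using second_difference_sums[OF a0] unfolding c_def by (rule sums_summable)
  ultimately have "summable (\<lambda>l. of_real (c l) * w ^ l)"
    using w by (rule summable_mult_unit_power)
  then have "summable (\<lambda>l. (of_real (c l) * w ^ l) * w ^ 2)"
    by (rule summable_mult2)
  then have "summable (\<lambda>l. of_real (c l) * w ^ (l + 2))"
    by (simp only: power_add mult.assoc)
  then have "(\<lambda>l. of_real (c l) * w ^ (l + 2)) sums (\<Sum>l. of_real (c l) * w ^ (l + 2))"
    by (rule summable_sums)
  then have lim_sum: "(\<lambda>N. \<Sum>l<N. of_real (c l) * w ^ (l + 2)) \<longlonglongrightarrow> (\<Sum>l. of_real (c l) * w ^ (l + 2))"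
    by (simp add: sums_def)
  \<comment> \<open>Powers of \<open>w\<close> have modulus 1, whatever the exponent; this disposes
    of both boundary terms.\<close>
  have null: "(\<lambda>N. of_real (b N) * w ^ f N) \<longlonglongrightarrow> 0" if "b \<longlonglongrightarrow> 0" for b :: "nat \<Rightarrow> real" and f
    by (rule Lim_null_comparison[OF _ tendsto_rabs_zero[OF that]]) (simp add: norm_mult norm_power w)
  have "(\<lambda>N. 2 * a N - a (Suc N)) \<longlonglongrightarrow> 2 * 0 - 0"
    by (intro tendsto_diff tendsto_mult tendsto_const LIMSEQ_Suc a0)
  then have lim2: "(\<lambda>N. of_real (2 * a N - a (Suc N)) * w ^ Suc N) \<longlonglongrightarrow> 0"
    by (intro null) simp
  have "(\<lambda>N. of_real (a 0) + of_real (a 1 - 2 * a 0) * w + (\<Sum>l<N. of_real (c l) * w ^ (l + 2))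
      - of_real (a N) * w ^ N + of_real (2 * a N - a (Suc N)) * w ^ Suc N)
    \<longlonglongrightarrow> of_real (a 0) + of_real (a 1 - 2 * a 0) * w + (\<Sum>l. of_real (c l) * w ^ (l + 2)) - 0 + 0"
    by (intro tendsto_add tendsto_diff tendsto_const lim_sum null[OF a0] lim2)
  then show ?thesis
    unfolding sums_def sum_second_difference_by_parts c_def
    by (simp only: of_real_add of_real_diff of_real_mult of_real_numeral diff_0_right add_0_right)
qed

lemma inverse_cbrt_tendsto_zero: "(\<lambda>l. real (l + 1) powr (-1/3)) \<longlonglongrightarrow> 0"
proof -
  have "(\<lambda>l. real l powr (-1/3)) \<longlonglongrightarrow> 0"
    by (rule tendsto_neg_powr[OF _ filterlim_real_sequentially]) simp
  from LIMSEQ_Suc[OF this] show ?thesis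
    by (simp only: Suc_eq_plus1)
qed

lemma inverse_cbrt_convex:
  "real (l + 2 + 1) powr (-1/3) - 2 * real (l + 1 + 1) powr (-1/3) + real (l + 1) powr (-1/3) > 0"
  using powr_minus_strict_midpoint[of "real (l + 1)" "1/3"] by (simp add: add_ac)

section \<open>Fourier modes and the amplification factor of an explicit scheme\<close>

lemma fourier_mode_shift:
  "exp (\<i> * of_real (k * (of_int (j - int m) * dx)))
    = exp (\<i> * of_real (k * (of_int j * dx))) * exp (- \<i> * of_real (k * dx)) ^ m"
  by (simp add: exp_of_nat_mult[symmetric] exp_add[symmetric] algebra_simps)

lemma fourier_mode_Suc:
  "exp (\<i> * of_real (k * (of_int (j + 1) * dx)))
    = exp (\<i> * of_real (k * (of_int j * dx))) * exp (\<i> * of_real (k * dx))"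
  by (simp add: exp_add[symmetric] algebra_simps)

lemma fourier_mode_pred:
  "exp (\<i> * of_real (k * (of_int (j - 1) * dx)))
    = exp (\<i> * of_real (k * (of_int j * dx))) * exp (- \<i> * of_real (k * dx))"
  using fourier_mode_shift[of k j 1] by simp

lemma exp_minus_i_times:
  "exp (- \<i> * of_real \<theta>) = of_real (cos \<theta>) - \<i> * of_real (sin \<theta>)"
  using exp_Euler[of "of_real (- \<theta>)"] by (simp add: cos_of_real sin_of_real)

lemma exp_i_times:
  "exp (\<i> * of_real \<theta>) = of_real (cos \<theta>) + \<i> * of_real (sin \<theta>)"
  using exp_minus_i_times[of "- \<theta>"] by simp

text \<open>The algebra of one time step: \<open>e\<close> is the mode at the grid point, and
  \<open>b\<close>, \<open>-r\<close> and \<open>m\<close> stand for the multipliers of the backward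
  difference, the second difference and the nonlocal operator.\<close>

lemma euler_step_factor:
  fixes d x :: "'a :: field"
  assumes "d \<noteq> 0" "x \<noteq> 0"
  shows "(u' * e - u * e) / d + v * (u * e * b / x) - \<epsilon> * (- (u * e * r) / x ^ 2) + \<eta> * (u * e * m)
    = e / d * (u' - (1 - v * d / x * b - \<epsilon> * d / x ^ 2 * r - \<eta> * d * m) * u)"
  using assms by (simp add: field_simps power2_eq_square)

text \<open>Treats both schemes at once: of the nonlocal operator it asks only that every Fourier
  mode be an eigenvector, with eigenvalue \<open>m (k * dx)\<close>.\<close>

lemma amplification_factor_explicit_scheme:
  assumes "dt \<noteq> 0" "dx \<noteq> 0"
    and I: "\<And>k U j. I dx (\<lambda>j. U * exp (\<i> * of_real (k * (of_int j * dx)))) j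
      = U * exp (\<i> * of_real (k * (of_int j * dx))) * m (k * dx)"
    and g: "\<And>\<theta>. g \<theta> = 1 - of_real (v * dt / dx) * (1 - exp (- \<i> * of_real \<theta>))
      - of_real (2 * (\<epsilon> * dt / dx ^ 2) * (1 - cos \<theta>)) - of_real (\<eta> * dt) * m \<theta>"
  shows "amplification_factor (explicit_scheme I v \<epsilon> \<eta> dx dt) dx g"
  unfolding amplification_factor_def explicit_scheme_def
proof (intro allI)
  fix k and U :: "nat \<Rightarrow> complex"
  define E where "E j = exp (\<i> * of_real (k * (of_int j * dx)))" for j :: int
  have cos2: "exp (\<i> * of_real (k * dx)) + exp (- \<i> * of_real (k * dx)) = 2 * of_real (cos (k * dx))"
    unfolding exp_i_times exp_minus_i_times by simp
  have step: "(U (Suc n) * E j - U n * E j) / of_real dt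
      + of_real v * ((U n * E j - U n * E (j - 1)) / of_real dx)
      - of_real \<epsilon> * ((U n * E (j + 1) - 2 * (U n * E j) + U n * E (j - 1)) / of_real (dx ^ 2))
      + of_real \<eta> * I dx (\<lambda>j. U n * E j) j
    = E j / of_real dt * (U (Suc n) - g (k * dx) * U n)" for n j
  proof -
    have "U n * E (j + 1) - 2 * (U n * E j) + U n * E (j - 1)
        = U n * E j * ((exp (\<i> * of_real (k * dx)) + exp (- \<i> * of_real (k * dx))) - 2)"
      unfolding E_def fourier_mode_Suc fourier_mode_pred by (simp add: algebra_simps)
    also have "\<dots> = - (U n * E j * of_real (2 * (1 - cos (k * dx))))"
      unfolding cos2 by (simp add: algebra_simps)
    finally have lap: "U n * E (j + 1) - 2 * (U n * E j) + U n * E (j - 1)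
        = - (U n * E j * of_real (2 * (1 - cos (k * dx))))" .
    have adv: "U n * E j - U n * E (j - 1) = U n * E j * (1 - exp (- \<i> * of_real (k * dx)))"
      unfolding E_def fourier_mode_pred by (simp add: algebra_simps)
    have nonloc: "I dx (\<lambda>j. U n * E j) j = U n * E j * m (k * dx)"
      unfolding E_def by (rule I)
    show ?thesis
      unfolding lap adv nonloc g
      using assms(1,2) by (subst of_real_power, subst euler_step_factor) (simp_all add: mult_ac)
  qed
  \<comment> \<open>By \<open>step\<close> the residual of the scheme is a multiple of the residual
    of the amplitude recursion. As the factor \<open>E j / of_real dt\<close> never vanishes, the
    two vanish together, which gives both directions.\<close>
  have "E j \<noteq> 0" for j by (simp add: E_def)
  then show "(\<forall>n j. (U (Suc n) * exp (\<i> * of_real (k * (of_int j * dx)))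
        - U n * exp (\<i> * of_real (k * (of_int j * dx)))) / of_real dt
      + of_real v * ((U n * exp (\<i> * of_real (k * (of_int j * dx)))
        - U n * exp (\<i> * of_real (k * (of_int (j - 1) * dx)))) / of_real dx)
      - of_real \<epsilon> * ((U n * exp (\<i> * of_real (k * (of_int (j + 1) * dx)))
        - 2 * (U n * exp (\<i> * of_real (k * (of_int j * dx))))
        + U n * exp (\<i> * of_real (k * (of_int (j - 1) * dx)))) / of_real (dx ^ 2))
      + of_real \<eta> * I dx (\<lambda>j. U n * exp (\<i> * of_real (k * (of_int j * dx)))) j = 0)
    \<longleftrightarrow> (\<forall>n. U (Suc n) = g (k * dx) * U n)"
    unfolding E_def[symmetric] step using assms(1) by simp
qed

section \<open>The first operator on Fourier modes\<close>

text \<open>The eigenvalue of the first operator on a mode, without the factor dx^(-4/3) and with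
  the coefficients of each power of exp(-i \<theta>) already collected.\<close>

definition symbol1 :: "real \<Rightarrow> complex" where
  "symbol1 \<theta> = 1 + of_real (2 powr (-1/3) - 2) * exp (- \<i> * of_real \<theta>)
    + (\<Sum>l. of_real (real (l + 3) powr (-1/3) - 2 * real (l + 2) powr (-1/3) + real (l + 1) powr (-1/3))
        * exp (- \<i> * of_real (real (l + 2) * \<theta>)))"

lemma exp_minus_mult_eq_power:
  "exp (- \<i> * of_real (real n * \<theta>)) = exp (- \<i> * of_real \<theta>) ^ n"
  by (simp add: exp_of_nat_mult[symmetric] algebra_simps)

lemma nonlocal1_fourier_mode:
  "nonlocal1 dx (\<lambda>j. U * exp (\<i> * of_real (k * (of_int j * dx)))) j
    = U * exp (\<i> * of_real (k * (of_int j * dx))) * (of_real (dx powr (-4/3)) * symbol1 (k * dx))"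
proof -
  define w where "w = exp (- \<i> * of_real (k * dx))"
  define E where "E j = exp (\<i> * of_real (k * (of_int j * dx)))" for j :: int
  have shift: "E (j - int m) = E j * w ^ m" for m
    unfolding E_def w_def by (rule fourier_mode_shift)
  \<comment> \<open>With the index starting at 0, the three grid values in term \<open>l\<close> sit
    at \<open>j - l\<close>, \<open>j - l - 1\<close> and \<open>j - l - 2\<close>, hence the
    exponents.\<close>
  have "(\<lambda>l. of_real (real (l + 1) powr (-1/3)) * (w ^ l - 2 * w ^ (l + 1) + w ^ (l + 2)))
      sums symbol1 (k * dx)"
    using second_difference_by_parts_sums[of "\<lambda>l. real (l + 1) powr (-1/3)" w,
        OF inverse_cbrt_tendsto_zero _ inverse_cbrt_convex]
    unfolding symbol1_def exp_minus_mult_eq_power w_def by (simp add: add_ac)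
  then have "(\<lambda>l. (U * E j) * (of_real (real (l + 1) powr (-1/3))
        * (w ^ l - 2 * w ^ (l + 1) + w ^ (l + 2)))) sums (U * E j * symbol1 (k * dx))"
    by (rule sums_mult)
  moreover have factor: "a * (U * (e * x) - 2 * (U * (e * y)) + U * (e * z)) = U * e * (a * (x - 2 * y + z))"
    for a e x y z :: complex
    by (simp add: algebra_simps)
  moreover have "of_real (real (l + 1) powr (-1/3)) * (U * E (j - int (l + 1) + 1)
        - 2 * (U * E (j - int (l + 1))) + U * E (j - int (l + 1) - 1))
      = (U * E j) * (of_real (real (l + 1) powr (-1/3)) * (w ^ l - 2 * w ^ (l + 1) + w ^ (l + 2)))" for l
  proof -
    have eqs: "j - int (l + 1) + 1 = j - int l" "j - int (l + 1) - 1 = j - int (l + 2)"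
      by simp_all
    show ?thesis
      unfolding eqs shift by (rule factor)
  qed
  ultimately have "(\<Sum>l. of_real (real (l + 1) powr (-1/3)) * (U * E (j - int (l + 1) + 1)
        - 2 * (U * E (j - int (l + 1))) + U * E (j - int (l + 1) - 1))) = U * E j * symbol1 (k * dx)"
    by (simp only: sums_iff)
  then show ?thesis
    unfolding nonlocal1_def E_def[symmetric] by simp
qed

lemma powr_minus_eq: "c * x / y powr (4/3) = c * x * y powr (-4/3)" for c x y :: real
  by (simp add: powr_minus_divide)

lemma amplification_factor_scheme1:
  assumes "dt \<noteq> 0" "dx \<noteq> 0"
  shows "amplification_factor (explicit_scheme nonlocal1 v \<epsilon> \<eta> dx dt) dx (g1 v \<epsilon> \<eta> dx dt)"
  using assms nonlocal1_fourier_mode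
proof (rule amplification_factor_explicit_scheme)
  fix \<theta> :: real
  define A B where "A = v * dt / dx" and "B = \<epsilon> * dt / dx ^ 2"
  show "g1 v \<epsilon> \<eta> dx dt \<theta> = 1 - of_real (v * dt / dx) * (1 - exp (- \<i> * of_real \<theta>))
      - of_real (2 * (\<epsilon> * dt / dx ^ 2) * (1 - cos \<theta>))
      - of_real (\<eta> * dt) * (of_real (dx powr (-4/3)) * symbol1 \<theta>)"
    unfolding g1_def symbol1_def powr_minus_eq A_def[symmetric] B_def[symmetric]
    by (simp add: algebra_simps)
qed

section \<open>Zeta values and the second operator on Fourier modes\<close>

lemma zeta_sums:
  assumes "s > 1"
  shows "(\<lambda>n. real (n + 1) powr (- s)) sums zeta s"
proof -
  have "summable (\<lambda>n. real n powr (- s))"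
    using assms by (simp add: summable_real_powr_iff)
  then have "summable (\<lambda>n. real (n + 1) powr (- s))"
    by (subst summable_iff_shift)
  then show ?thesis
    by (simp add: zeta_def summable_sums)
qed

lemma zeta_tail_sums:
  assumes "s > 1"
  shows "(\<lambda>n. real (n + 2) powr (- s)) sums (zeta s - 1)"
  using sums_split_initial_segment[OF zeta_sums[OF assms], of 1] by (simp add: add_ac)

text \<open>The eigenvalue of the second operator without dx^(-4/3). The centred difference
  contributes i sin \<theta>, weighted by l * l^(-7/3) = l^(-4/3), whose sum is
  \<open>zeta (4/3)\<close>; the term l = 1 of the remaining series is split off as in
  \<open>g2\<close>.\<close>

definition symbol2 :: "real \<Rightarrow> complex" where
  "symbol2 \<theta> = 4/9 * (exp (- \<i> * of_real \<theta>)
      + (\<Sum>l. of_real (real (l + 2) powr (-7/3)) * exp (- \<i> * of_real (real (l + 2) * \<theta>)))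
      - of_real (zeta (7/3)) + of_real (zeta (4/3)) * (\<i> * of_real (sin \<theta>)))"

lemma nonlocal2_fourier_mode:
  "nonlocal2 dx (\<lambda>j. U * exp (\<i> * of_real (k * (of_int j * dx)))) j
    = U * exp (\<i> * of_real (k * (of_int j * dx))) * (of_real (dx powr (-4/3)) * symbol2 (k * dx))"
proof -
  define w where "w = exp (- \<i> * of_real (k * dx))"
  define E where "E j = exp (\<i> * of_real (k * (of_int j * dx)))" for j :: int
  define S where "S = (\<Sum>l. of_real (real (l + 2) powr (-7/3)) * w ^ (l + 2))"
  have w: "cmod w = 1" by (simp add: w_def)
  have shift: "E (j - int m) = E j * w ^ m" for m
    unfolding E_def w_def by (rule fourier_mode_shift)
  have diff: "E (j + 1) - E (j - 1) = E j * (2 * (\<i> * of_real (sin (k * dx))))"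
  proof -
    have "exp (\<i> * of_real (k * dx)) - exp (- \<i> * of_real (k * dx)) = 2 * (\<i> * of_real (sin (k * dx)))"
      unfolding exp_i_times exp_minus_i_times by simp
    then show ?thesis
      unfolding E_def fourier_mode_Suc fourier_mode_pred by (simp flip: right_diff_distrib)
  qed
  have z7: "(\<lambda>l. real (l + 1) powr (-7/3)) sums zeta (7/3)"
    using zeta_sums[of "7/3"] by simp
  have z4: "(\<lambda>l. real (l + 1) powr (-4/3)) sums zeta (4/3)"
    using zeta_sums[of "4/3"] by simp
  \<comment> \<open>The three parts of each summand converge separately, so they can be summed one
    by one.\<close>
  have "summable (\<lambda>l. of_real (real (l + 1) powr (-7/3)) * w ^ l)"
    using z7 w by (intro summable_mult_unit_power) (auto simp: sums_iff)
  then have "summable (\<lambda>l. of_real (real (l + 1) powr (-7/3)) * w ^ l * w)"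
    by (rule summable_mult2)
  then have "(\<lambda>l. of_real (real (l + 1) powr (-7/3)) * w ^ (l + 1)) sums (w + S)"
    using suminf_split_head[of "\<lambda>l. of_real (real (l + 1) powr (-7/3)) * w ^ (l + 1)"]
    by (simp add: sums_iff S_def mult_ac add_ac)
  then have "(\<lambda>l. of_real (real (l + 1) powr (-7/3)) * w ^ (l + 1) - of_real (real (l + 1) powr (-7/3))
        + of_real (real (l + 1) powr (-4/3)) * (\<i> * of_real (sin (k * dx))))
      sums (w + S - of_real (zeta (7/3)) + of_real (zeta (4/3)) * (\<i> * of_real (sin (k * dx))))"
    by (intro sums_add sums_diff sums_mult2 sums_of_real z7 z4)
  then have "(\<lambda>l. (U * E j) * (of_real (real (l + 1) powr (-7/3)) * w ^ (l + 1)
        - of_real (real (l + 1) powr (-7/3))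
        + of_real (real (l + 1) powr (-4/3)) * (\<i> * of_real (sin (k * dx)))))
      sums (U * E j * (w + S - of_real (zeta (7/3)) + of_real (zeta (4/3)) * (\<i> * of_real (sin (k * dx)))))"
    by (rule sums_mult)
  moreover have factor: "a * (U * (e * x - e) + n * (U * (e * (2 * s)) / 2)) = U * e * (a * x - a + a * n * s)"
    for a e x n s :: complex
    by (simp add: algebra_simps)
  moreover have "of_real (real (l + 1) powr (-7/3)) * (U * E (j - int (l + 1)) - U * E j
        + of_nat (l + 1) * ((U * E (j + 1) - U * E (j - 1)) / 2))
      = (U * E j) * (of_real (real (l + 1) powr (-7/3)) * w ^ (l + 1)
        - of_real (real (l + 1) powr (-7/3))
        + of_real (real (l + 1) powr (-4/3)) * (\<i> * of_real (sin (k * dx))))" for l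
  proof -
    have "real (l + 1) powr (-4/3) = real (l + 1) powr (-7/3 + 1)" by simp
    also have "\<dots> = real (l + 1) powr (-7/3) * real (l + 1)"
      by (subst powr_add) simp
    finally have p: "complex_of_real (real (l + 1) powr (-4/3))
        = of_real (real (l + 1) powr (-7/3)) * of_nat (l + 1)"
      by (simp only: of_real_mult of_real_of_nat_eq)
    show ?thesis
      unfolding shift p right_diff_distrib[of U, symmetric] diff
      by (rule factor)
  qed
  ultimately have sum: "(\<Sum>l. of_real (real (l + 1) powr (-7/3)) * (U * E (j - int (l + 1)) - U * E j
        + of_nat (l + 1) * ((U * E (j + 1) - U * E (j - 1)) / 2)))
      = U * E j * (w + S - of_real (zeta (7/3)) + of_real (zeta (4/3)) * (\<i> * of_real (sin (k * dx))))"
    by (simp only: sums_iff)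
  show ?thesis
    unfolding nonlocal2_def E_def[symmetric] sum symbol2_def exp_minus_mult_eq_power w_def[symmetric]
      S_def[symmetric]
    by simp
qed

lemma amplification_factor_scheme2:
  assumes "dt \<noteq> 0" "dx \<noteq> 0"
  shows "amplification_factor (explicit_scheme nonlocal2 v \<epsilon> \<eta> dx dt) dx (g2 v \<epsilon> \<eta> dx dt)"
  using assms nonlocal2_fourier_mode
proof (rule amplification_factor_explicit_scheme)
  fix \<theta> :: real
  define A B where "A = v * dt / dx" and "B = \<epsilon> * dt / dx ^ 2"
  have sin_half: "4 * B * (sin (\<theta> / 2))\<^sup>2 = 2 * B * (1 - cos \<theta>)"
    using cos_double_sin[of "\<theta> / 2"] by simp
  show "g2 v \<epsilon> \<eta> dx dt \<theta> = 1 - of_real (v * dt / dx) * (1 - exp (- \<i> * of_real \<theta>))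
      - of_real (2 * (\<epsilon> * dt / dx ^ 2) * (1 - cos \<theta>))
      - of_real (\<eta> * dt) * (of_real (dx powr (-4/3)) * symbol2 \<theta>)"
    \<comment> \<open>Writing exp(-i \<theta>) as cos \<theta> - i sin \<theta> gives -i sin
      \<theta> = exp(-i \<theta>) - cos \<theta>. This is how the sine in the symbol becomes the two
      \<open>zeta (4/3)\<close> terms of \<open>g2\<close>.\<close>
    unfolding g2_def symbol2_def powr_minus_eq sin_half exp_minus_i_times A_def[symmetric] B_def[symmetric]
    by (simp add: field_simps)
qed

section \<open>Modulus estimates for the amplification factors\<close>

lemma exp_minus_neq_one:
  assumes "0 < \<theta>" "\<theta> \<le> pi"
  shows "exp (- \<i> * of_real \<theta>) \<noteq> 1"
proof
  assume "exp (- \<i> * of_real \<theta>) = 1"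
  then have "Re (exp (- \<i> * of_real \<theta>)) = Re 1" by (rule arg_cong)
  then have "cos \<theta> = 1" by (simp add: Re_exp)
  moreover have "cos \<theta> < cos 0" using assms by (intro cos_monotone_0_pi) auto
  ultimately show False by simp
qed

lemma norm_suminf_exp_less:
  fixes c :: "nat \<Rightarrow> real"
  assumes "\<And>n. c n > 0" "c sums C" "0 < \<theta>" "\<theta> \<le> pi"
  shows "cmod (\<Sum>l. of_real (c l) * exp (- \<i> * of_real (real (l + 2) * \<theta>))) < C"
proof -
  define w where "w = exp (- \<i> * of_real \<theta>)"
  have w: "cmod w = 1" "w \<noteq> 1"
    using exp_minus_neq_one[OF assms(3,4)] by (simp_all add: w_def)
  have c: "summable c" "suminf c = C" using assms(2) by (auto simp: sums_iff)
  \<comment> \<open>The exponents start at 2; the common factor \<open>w ^ 2\<close> has modulus 1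
    and can be pulled out.\<close>
  have "(\<Sum>l. of_real (c l) * exp (- \<i> * of_real (real (l + 2) * \<theta>)))
      = (\<Sum>l. of_real (c l) * w ^ l * w ^ 2)"
    by (simp only: exp_minus_mult_eq_power w_def power_add mult.assoc)
  also have "\<dots> = (\<Sum>l. of_real (c l) * w ^ l) * w ^ 2"
    by (rule suminf_mult2[symmetric, OF summable_mult_unit_power[OF assms(1) c(1) w(1)]])
  also have "cmod \<dots> = cmod (\<Sum>l. of_real (c l) * w ^ l)"
    by (simp add: norm_mult norm_power w(1))
  finally show ?thesis
    using norm_suminf_power_less[OF assms(1) c(1) w] c(2) by simp
qed

text \<open>The triangle inequality leaves \<open>\<bar>p\<bar> + q + r * cmod S\<close>. The last
  two hypotheses cover the two signs of \<open>p\<close>, and the strict bound on \<open>S\<close>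
  keeps the result strict even if they hold with equality.\<close>

lemma norm_amplification_less:
  fixes p q r C :: real
  assumes "q \<ge> 0" "r > 0" "cmod S < C" "p + q + r * C \<le> 1" "- p + q + r * C \<le> 1"
  shows "cmod (of_real p + of_real q * exp (- \<i> * of_real \<theta>) - of_real r * S) < 1"
proof -
  have "cmod (of_real p + of_real q * exp (- \<i> * of_real \<theta>) - of_real r * S)
      \<le> cmod (of_real p + of_real q * exp (- \<i> * of_real \<theta>)) + cmod (of_real r * S)"
    by (rule norm_triangle_ineq4)
  also have "\<dots> \<le> cmod (of_real p) + cmod (of_real q * exp (- \<i> * of_real \<theta>)) + cmod (of_real r * S)"
    by (intro add_right_mono norm_triangle_ineq)
  also have "\<dots> = \<bar>p\<bar> + q + r * cmod S"
    using assms(1,2) by (simp add: norm_mult)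
  also have "\<dots> < \<bar>p\<bar> + q + r * C"
    using assms(2,3) by simp
  also have "\<dots> \<le> 1"
    using assms(4,5) by (auto simp: abs_if)
  finally show ?thesis .
qed

text \<open>Half angles stay in (0, pi/2], where the sine is nonnegative and increasing. This
  carries the condition at \<open>\<theta>\<^sub>0\<close> over to all higher frequencies.\<close>

lemma sin_half_squared_mono:
  assumes "0 < \<theta>\<^sub>0" "\<theta>\<^sub>0 < \<theta>" "\<theta> \<le> pi"
  shows "(sin (\<theta>\<^sub>0 / 2))\<^sup>2 \<le> (sin (\<theta> / 2))\<^sup>2"
proof (rule power_mono)
  show "sin (\<theta>\<^sub>0 / 2) \<le> sin (\<theta> / 2)"
    using assms by (intro sin_monotone_2pi_le) auto
  show "0 \<le> sin (\<theta>\<^sub>0 / 2)"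
    using assms by (intro sin_ge_zero) auto
qed

lemma norm_g1_less:
  fixes v \<epsilon> \<eta> dx dt :: real
  defines "A \<equiv> v * dt / dx" and "B \<equiv> \<epsilon> * dt / dx ^ 2" and "C \<equiv> \<eta> * dt / dx powr (4/3)"
  assumes pos: "A > 0" "B > 0" "C > 0"
    and "0 < \<theta>\<^sub>0" "\<theta> \<in> {\<theta>\<^sub>0<..pi}"
    and cfl: "A + 2 * B + (2 - 2 powr (-1/3)) * C \<le> 1"
    and thr: "(1 - 2 powr (-1/3)) * C \<le> 2 * B * (sin (\<theta>\<^sub>0 / 2))\<^sup>2"
  shows "cmod (g1 v \<epsilon> \<eta> dx dt \<theta>) < 1"
proof -
  have \<theta>: "0 < \<theta>\<^sub>0" "\<theta>\<^sub>0 < \<theta>" "\<theta> \<le> pi"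
    using assms(7,8) by auto
  define a :: real where "a = 2 powr (-1/3)"
  have "a < 2 powr 0" unfolding a_def by (intro powr_less_mono) auto
  then have a: "a < 1" by simp
  have cos: "1 - cos \<theta> = 2 * (sin (\<theta> / 2))\<^sup>2"
    using cos_double_sin[of "\<theta> / 2"] by simp
  have s: "B * (sin (\<theta>\<^sub>0 / 2))\<^sup>2 \<le> B * (sin (\<theta> / 2))\<^sup>2" "B * (sin (\<theta> / 2))\<^sup>2 \<le> B"
    using sin_half_squared_mono[OF \<theta>] pos(2) by (auto simp: abs_square_le_1)
  have "(\<lambda>l. real (l + 3) powr (-1/3) - 2 * real (l + 2) powr (-1/3) + real (l + 1) powr (-1/3))
      sums (1 - a)"
    using second_difference_sums[OF inverse_cbrt_tendsto_zero] by (simp add: a_def add_ac)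
  moreover have "real (l + 3) powr (-1/3) - 2 * real (l + 2) powr (-1/3) + real (l + 1) powr (-1/3) > 0" for l
    using inverse_cbrt_convex[of l] by (simp add: add_ac)
  ultimately have S: "cmod (\<Sum>l. of_real (real (l + 3) powr (-1/3) - 2 * real (l + 2) powr (-1/3)
      + real (l + 1) powr (-1/3)) * exp (- \<i> * of_real (real (l + 2) * \<theta>))) < 1 - a"
    using \<theta> by (intro norm_suminf_exp_less) auto
  have "a * C < C" using a pos(3) by simp
  show ?thesis
    unfolding g1_def A_def[symmetric] B_def[symmetric] C_def[symmetric] a_def[symmetric]
  proof (rule norm_amplification_less[OF _ pos(3) S])
    show "0 \<le> A + (2 - a) * C" using a pos by simp
    \<comment> \<open>The left side is 1 + 2(1-a)C - 4B sin^2(\<theta>/2), so this is the threshold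
      condition.\<close>
    show "1 - A - 2 * B * (1 - cos \<theta>) - C + (A + (2 - a) * C) + C * (1 - a) \<le> 1"
      using thr s unfolding cos a_def[symmetric] by (simp add: algebra_simps)
    \<comment> \<open>After adding 1 and halving, this reads A + 2B sin^2(\<theta>/2) + (2-a)C \<le>
      1, which the first condition gives since sin^2 is at most 1.\<close>
    show "- (1 - A - 2 * B * (1 - cos \<theta>) - C) + (A + (2 - a) * C) + C * (1 - a) \<le> 1"
      using cfl s unfolding cos a_def[symmetric] by (simp add: algebra_simps)
  qed
qed

lemma zeta_ge_1:
  assumes "s > 1"
  shows "zeta s \<ge> 1"
  using sums_le[OF _ sums_zero zeta_tail_sums[OF assms]] by simp

lemma norm_g2_less:
  fixes v \<epsilon> \<eta> dx dt :: real
  defines "A \<equiv> v * dt / dx" and "B \<equiv> \<epsilon> * dt / dx ^ 2" and "C \<equiv> \<eta> * dt / dx powr (4/3)"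
  assumes pos: "A > 0" "B > 0" "C > 0"
    and "0 < \<theta>\<^sub>0" "\<theta> \<in> {\<theta>\<^sub>0<..pi}"
    and cfl: "A + 2 * B + 4/9 * (zeta (4/3) - 1) * C \<le> 1"
    and thr: "4/9 * (zeta (7/3) - 1 + zeta (4/3)) * C \<le> 2 * B * (sin (\<theta>\<^sub>0 / 2))\<^sup>2"
  shows "cmod (g2 v \<epsilon> \<eta> dx dt \<theta>) < 1"
proof -
  have \<theta>: "0 < \<theta>\<^sub>0" "\<theta>\<^sub>0 < \<theta>" "\<theta> \<le> pi"
    using assms(7,8) by auto
  define z where "z = zeta (4/3)"
  have z: "z \<ge> 1" by (simp add: z_def zeta_ge_1)
  have s: "B * (sin (\<theta>\<^sub>0 / 2))\<^sup>2 \<le> B * (sin (\<theta> / 2))\<^sup>2" "B * (sin (\<theta> / 2))\<^sup>2 \<le> B"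
    using sin_half_squared_mono[OF \<theta>] pos(2) by (auto simp: abs_square_le_1)
  define D where "D = 4/9 * C"
  have D: "D > 0" "4/9 * x * C = x * D" for x using pos(3) by (simp_all add: D_def)
  \<comment> \<open>The cosine in the real coefficient has either sign: cos \<theta> \<ge> -1 is the
    worst case for the threshold condition, cos \<theta> \<le> 1 for the time step
    condition.\<close>
  have zD: "z * D * cos \<theta> \<le> z * D" "- (z * D) \<le> z * D * cos \<theta>"
    using z D(1) mult_left_mono[of "cos \<theta>" 1 "z * D"] mult_left_mono[of "-1" "cos \<theta>" "z * D"]
    by simp_all
  have S: "cmod (\<Sum>l. of_real (real (l + 2) powr (-7/3)) * exp (- \<i> * of_real (real (l + 2) * \<theta>)))
      < zeta (7/3) - 1"
    using \<theta> zeta_tail_sums[of "7/3"] by (intro norm_suminf_exp_less) auto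
  show ?thesis
    unfolding g2_def A_def[symmetric] B_def[symmetric] C_def[symmetric] z_def[symmetric]
      D(2) D_def[symmetric]
  proof (rule norm_amplification_less[OF _ D(1) S])
    show "0 \<le> A + (z - 1) * D" using z D(1) pos by simp
    show "1 - A - 4 * B * (sin (\<theta> / 2))\<^sup>2 + (zeta (7/3) - z * cos \<theta>) * D
        + (A + (z - 1) * D) + D * (zeta (7/3) - 1) \<le> 1"
      using thr s zD unfolding z_def[symmetric] D(2) by (simp add: algebra_simps)
    \<comment> \<open>Here \<open>zeta (7/3)\<close> cancels between the real coefficient and the
      bound on the series, which is why the time step condition contains only
      \<open>zeta (4/3)\<close>.\<close>
    show "- (1 - A - 4 * B * (sin (\<theta> / 2))\<^sup>2 + (zeta (7/3) - z * cos \<theta>) * D)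
        + (A + (z - 1) * D) + D * (zeta (7/3) - 1) \<le> 1"
      using cfl s zD unfolding z_def[symmetric] D(2) by (simp add: algebra_simps)
  qed
qed

theorem proposition1:
  fixes v \<epsilon> \<eta> dx dt \<theta>\<^sub>0 :: real
  assumes "v > 0" and "\<epsilon> > 0" and "\<eta> > 0"
    and "dx > 0" and "dt > 0"
    and "0 < \<theta>\<^sub>0" and "\<theta>\<^sub>0 < pi"
  shows
    "(v * dt / dx + 2 * (\<epsilon> * dt / dx ^ 2)
        + (2 - 2 powr (-1/3)) * (\<eta> * dt / dx powr (4/3)) \<le> 1 \<and>
      (1 - 2 powr (-1/3)) * (\<eta> * dt / dx powr (4/3))
        \<le> 2 * (\<epsilon> * dt / dx ^ 2) * (sin (\<theta>\<^sub>0 / 2)) ^ 2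
      \<longrightarrow> amplification_factor (explicit_scheme nonlocal1 v \<epsilon> \<eta> dx dt) dx (g1 v \<epsilon> \<eta> dx dt) \<and>
          stable_with_threshold (g1 v \<epsilon> \<eta> dx dt) \<theta>\<^sub>0)
     \<and>
     (v * dt / dx + 2 * (\<epsilon> * dt / dx ^ 2)
        + 4/9 * (zeta (4/3) - 1) * (\<eta> * dt / dx powr (4/3)) \<le> 1 \<and>
      4/9 * (zeta (7/3) - 1 + zeta (4/3)) * (\<eta> * dt / dx powr (4/3))
        \<le> 2 * (\<epsilon> * dt / dx ^ 2) * (sin (\<theta>\<^sub>0 / 2)) ^ 2
      \<longrightarrow> amplification_factor (explicit_scheme nonlocal2 v \<epsilon> \<eta> dx dt) dx (g2 v \<epsilon> \<eta> dx dt) \<and>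
          stable_with_threshold (g2 v \<epsilon> \<eta> dx dt) \<theta>\<^sub>0)"
proof -
  have pos: "v * dt / dx > 0" "\<epsilon> * dt / dx ^ 2 > 0" "\<eta> * dt / dx powr (4/3) > 0" and "dt \<noteq> 0" "dx \<noteq> 0"
    using assms by simp_all
  then show ?thesis
    unfolding stable_with_threshold_def using assms(6,7)
    by (blast intro: amplification_factor_scheme1 amplification_factor_scheme2
        norm_g1_less[OF pos] norm_g2_less[OF pos])
qed

end
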